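(* Let $n\geq 5$. For every spanning tree $G$ of $C_n^2$ there exists a unique nontrivial connected spanning convex subgraph $H$ of $C_n^2$ such that $E(G)\subseteq E(H)$. More precisely, denoting by $T_X$ the set of spanning trees of a graph $X$, \[ T_{C_n^2}=\bigcup_{k=0}^{\lceil\frac{n-2}{2}\rceil}\ \bigcup_{j=0}^{n-1} T_{S_{n,k,j}}, \] and this union is disjoint.
   Context: For $n\geq 5$, the square cycle $C_n^2$ has vertex set $\mathbb{Z}_n=\mathbb{Z}/n\mathbb{Z}$, with $v_i=i+n\mathbb{Z}$ for $i\in\mathbb{Z}$, and edge set $\{\{v_i,v_j\}: i-j\in\{1,2\}\}$. For $i\in\mathbb{Z}$ write $e_i=\{v_i,v_{i+1}\}$ (frames) and $f_i=\{v_i,v_{i+2}\}$ (windows), indices modulo $n$. A spanning subgraph has vertex set all of $\mathbb{Z}_n$; a spanning tree is a spanning subgraph which is a tree. The triangles are $T_i=\{e_i,e_{i+1},f_i\}$; a subgraph $G$ is convex if for every $i$, either $|T_i\cap E(G)|\leq1$ or $T_i\subseteq E(G)$. The trivial connected spanning subgraphs are $C_n^2$ itself and, when $n$ is odd, the graph $(\mathbb{Z}_n,\{f_0,\dots,f_{n-1}\})$; "nontrivial" means not one of these. For integers $j,k$ with $0\leq k\leq\lceil\frac{n-2}{2}\rceil$, $S_{n,k,j}$ is the graph with vertex set $\mathbb{Z}_n$ and edge set $E(C_n^2)\setminus\big(\{f_j,f_{j+2k+1}\}\cup\{e_{j+1},\dots,e_{j+2k+1}\}\big)$. *)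

theory Defs
  imports Complex_Main "HOL-Library.Disjoint_Sets"
begin

text \<open>
  Undirected simple graphs, with edges as two-element sets of vertices. The digraphs of the AFP
  entry Graph_Theory are not used: its cycles are directed cycles, so that every edge of a
  symmetric digraph already gives a cycle of length two, and its trees are not the trees of
  undirected graph theory.
\<close>

record 'a ugraph =
  vertices :: "'a set"
  edges :: "'a set set"

definition simple_graph :: "'a ugraph \<Rightarrow> bool" where
  "simple_graph G \<longleftrightarrow> (\<forall>e\<in>edges G. e \<subseteq> vertices G \<and> card e = 2)"

definition is_subgraph :: "'a ugraph \<Rightarrow> 'a ugraph \<Rightarrow> bool" where
  "is_subgraph H G \<longleftrightarrow> simple_graph H \<and> vertices H \<subseteq> vertices G \<and> edges H \<subseteq> edges G"

definition is_spanning_subgraph :: "'a ugraph \<Rightarrow> 'a ugraph \<Rightarrow> bool" where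
  "is_spanning_subgraph H G \<longleftrightarrow> is_subgraph H G \<and> vertices H = vertices G"

definition adjacency :: "'a ugraph \<Rightarrow> 'a rel" where
  "adjacency G = {(u, v). {u, v} \<in> edges G}"

definition connected_graph :: "'a ugraph \<Rightarrow> bool" where
  "connected_graph G \<longleftrightarrow>
     vertices G \<noteq> {} \<and> (\<forall>u\<in>vertices G. \<forall>v\<in>vertices G. (u, v) \<in> (adjacency G)\<^sup>*)"

text \<open>A cycle is given by the list of its vertices, without repeating the first one at the end.\<close>

definition is_graph_cycle :: "'a ugraph \<Rightarrow> 'a list \<Rightarrow> bool" where
  "is_graph_cycle G vs \<longleftrightarrow>
     length vs \<ge> 3 \<and> distinct vs \<and>
     (\<forall>i<length vs. {vs ! i, vs ! (Suc i mod length vs)} \<in> edges G)"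

definition is_tree :: "'a ugraph \<Rightarrow> bool" where
  "is_tree G \<longleftrightarrow> simple_graph G \<and> connected_graph G \<and> (\<nexists>vs. is_graph_cycle G vs)"

definition is_spanning_tree :: "'a ugraph \<Rightarrow> 'a ugraph \<Rightarrow> bool" where
  "is_spanning_tree G X \<longleftrightarrow> is_spanning_subgraph G X \<and> is_tree G"

definition spanning_trees :: "'a ugraph \<Rightarrow> 'a ugraph set" where
  "spanning_trees X = {G. is_spanning_tree G X}"

text \<open>
  A residue class modulo \<open>n\<close> is represented by its least nonnegative element, so the vertex set
  is \<open>{0..<int n}\<close>. All indices of vertices, frames, windows and triangles are arbitrary integers.
\<close>

definition sc_vertex :: "nat \<Rightarrow> int \<Rightarrow> int" where
  "sc_vertex n i = i mod int n"

definition square_cycle :: "nat \<Rightarrow> int ugraph" where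
  "square_cycle n =
     \<lparr> vertices = {0..<int n},
       edges = {{sc_vertex n i, sc_vertex n j} | i j. i - j \<in> {1, 2}} \<rparr>"

definition frame :: "nat \<Rightarrow> int \<Rightarrow> int set" where
  "frame n i = {sc_vertex n i, sc_vertex n (i + 1)}"

definition window :: "nat \<Rightarrow> int \<Rightarrow> int set" where
  "window n i = {sc_vertex n i, sc_vertex n (i + 2)}"

definition triangle :: "nat \<Rightarrow> int \<Rightarrow> int set set" where
  "triangle n i = {frame n i, frame n (i + 1), window n i}"

definition convex_subgraph :: "nat \<Rightarrow> int ugraph \<Rightarrow> bool" where
  "convex_subgraph n G \<longleftrightarrow>
     is_subgraph G (square_cycle n) \<and>
     (\<forall>i. card (triangle n i \<inter> edges G) \<le> 1 \<or> triangle n i \<subseteq> edges G)"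

definition trivial_subgraph :: "nat \<Rightarrow> int ugraph \<Rightarrow> bool" where
  "trivial_subgraph n G \<longleftrightarrow>
     G = square_cycle n \<or>
     odd n \<and> G = \<lparr> vertices = {0..<int n}, edges = window n ` {0..int n - 1} \<rparr>"

definition S_graph :: "nat \<Rightarrow> int \<Rightarrow> int \<Rightarrow> int ugraph" where
  "S_graph n k j =
     \<lparr> vertices = {0..<int n},
       edges = edges (square_cycle n) -
         ({window n j, window n (j + 2 * k + 1)} \<union> frame n ` {j + 1..j + 2 * k + 1}) \<rparr>"

end

theory Submission
  imports Defs
begin

text \<open>
  Record a spanning subgraph by which of its frames and windows are present. Convexity says that no
  triangle misses exactly one edge, so the absent edges propagate: every absent window
  \<open>f\<^sub>a\<close> is joined to another absent window \<open>f\<^bsub>a+m\<^esub>\<close> by a run of absent frames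
  \<open>e\<^bsub>a+1\<^esub>, \<dots>, e\<^bsub>a+m\<^esub>\<close>, up to reflection. If \<open>m\<close> is even, this gap isolates the vertices
  \<open>a + 2, a + 4, \<dots>, a + m\<close>; two disjoint odd gaps together disconnect the graph. Hence a
  nontrivial connected convex graph has a single odd gap and is some \<open>S\<^bsub>n,k,j\<^esub>\<close>, and no two distinct
  such graphs contain a common connected graph, because their intersection would again be convex.

  Conversely, close a spanning tree under completion of triangles. Each step adds one edge and fills
  at least one new triangle. There are only \<open>n\<close> triangles but \<open>n + 1\<close> edges outside the tree, so the
  closure is not the whole graph.
\<close>

section \<open>Acyclic graphs\<close>

text \<open>On a longest path, every neighbour of the first vertex lies on the path; a neighbour
  other than the second vertex closes a cycle.\<close>

lemma exists_cycle_of_min_degree_two: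
  assumes fin: "finite (vertices G)" and simple: "simple_graph G" and ne: "vertices G \<noteq> {}"
    and deg: "\<And>v. v \<in> vertices G \<Longrightarrow> \<exists>x y. x \<noteq> y \<and> {v, x} \<in> edges G \<and> {v, y} \<in> edges G"
  shows "\<exists>vs. is_graph_cycle G vs"
proof -
  define P where "P vs \<longleftrightarrow> vs \<noteq> [] \<and> distinct vs \<and> set vs \<subseteq> vertices G \<and>
    (\<forall>i. Suc i < length vs \<longrightarrow> {vs ! i, vs ! Suc i} \<in> edges G)" for vs
  obtain v where "v \<in> vertices G" using ne by blast
  then have "P [v]" by (simp add: P_def)
  moreover have "\<forall>vs. P vs \<longrightarrow> length vs < Suc (card (vertices G))"
    unfolding P_def less_Suc_eq_le by (metis card_mono distinct_card fin)
  ultimately have "\<exists>vs. P vs \<and> (\<forall>ws. P ws \<longrightarrow> length ws \<le> length vs)"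
    by (rule ex_has_greatest_nat[of P "[v]" length])
  then obtain vs where vs: "P vs" and longest: "\<And>ws. P ws \<Longrightarrow> length ws \<le> length vs"
    by blast
  obtain u us where u: "vs = u # us" using vs by (cases vs) (auto simp: P_def)
  have nbr: "w \<in> set us" if "{u, w} \<in> edges G" for w
  proof (rule ccontr)
    assume "w \<notin> set us"
    moreover have "{u, w} \<subseteq> vertices G" "card {u, w} = 2"
      using simple that by (auto simp: simple_graph_def)
    moreover from this have "w \<noteq> u" by auto
    ultimately have "P (w # vs)"
      using vs that u by (auto simp: P_def nth_Cons insert_commute split: nat.splits)
    then show False using longest by fastforce
  qed
  obtain x y where xy: "x \<noteq> y" "{u, x} \<in> edges G" "{u, y} \<in> edges G"
    using deg[of u] vs u by (auto simp: P_def)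
  \<comment> \<open>Two distinct neighbours of \<open>u\<close> cannot both be the second vertex
    \<open>us ! 0\<close>.\<close>
  obtain w where w: "w \<in> set us" "w \<noteq> us ! 0" "{u, w} \<in> edges G"
    using nbr xy by metis
  obtain q where q: "q < length us" "us ! q = w" using w(1) by (auto simp: in_set_conv_nth)
  have "q \<noteq> 0" using q w by metis
  \<comment> \<open>Position \<open>q\<close> in \<open>us\<close> is position \<open>q + 1\<close>
    in \<open>vs\<close>, so this prefix ends at \<open>w\<close>.\<close>
  have "is_graph_cycle G (take (q + 2) vs)"
    unfolding is_graph_cycle_def
  proof (intro conjI allI impI)
    have len: "length (take (q + 2) vs) = q + 2" using q u by simp
    show "3 \<le> length (take (q + 2) vs)" using len \<open>q \<noteq> 0\<close> by simp
    show "distinct (take (q + 2) vs)" using vs by (simp add: P_def)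
    fix i assume "i < length (take (q + 2) vs)"
    then have i: "i < q + 2" using len by simp
    show "{take (q + 2) vs ! i, take (q + 2) vs ! (Suc i mod length (take (q + 2) vs))} \<in> edges G"
    proof (cases "i = q + 1")
      case True
      then show ?thesis unfolding len using q w u by (simp add: insert_commute)
    next
      case False
      then show ?thesis unfolding len using i q vs
        by (metis (no_types, lifting) P_def Suc_lessI add_2_eq_Suc' add_Suc_right length_Cons less_Suc_eq mod_less
            nth_take u One_nat_def add.right_neutral Suc_less_eq less_trans_Suc)
    qed
  qed
  then show ?thesis by blast
qed

text \<open>By the previous lemma some vertex has at most one incident edge; deleting it loses one
  vertex and at most one edge.\<close>

lemma card_edges_less_card_vertices:
  assumes "finite (vertices G)" "vertices G \<noteq> {}" "simple_graph G" "\<nexists>vs. is_graph_cycle G vs"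
  shows "card (edges G) < card (vertices G)"
  using assms
proof (induction "card (vertices G)" arbitrary: G rule: less_induct)
  case less
  obtain v where v: "v \<in> vertices G"
    and deg: "\<And>x y. {v, x} \<in> edges G \<Longrightarrow> {v, y} \<in> edges G \<Longrightarrow> x = y"
    using exists_cycle_of_min_degree_two[OF less.prems(1,3,2)] less.prems(4) by metis
  define G' where "G' = \<lparr>vertices = vertices G - {v}, edges = {e \<in> edges G. v \<notin> e}\<rparr>"
  define D where "D = {e \<in> edges G. v \<in> e}"
  have finE: "finite (edges G)"
    by (rule finite_subset[of _ "Pow (vertices G)"])
       (use less.prems in \<open>auto simp: simple_graph_def\<close>)
  have D_form: "\<exists>x. e = {v, x}" if "e \<in> D" for e
  proof -
    have "card e = 2" "v \<in> e" using that less.prems(3) by (auto simp: D_def simple_graph_def)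
    then show ?thesis by (auto simp: card_2_iff)
  qed
  have "card D \<le> 1"
  proof -
    have "finite D" using finE by (simp add: D_def)
    moreover have "e = e'" if "e \<in> D" "e' \<in> D" for e e'
      using D_form[OF that(1)] D_form[OF that(2)] that deg by (auto simp: D_def)
    ultimately show ?thesis by (simp add: card_le_Suc0_iff_eq)
  qed
  \<comment> \<open>The induction hypothesis asks for a nonempty vertex set, so a single vertex is
    treated separately.\<close>
  show ?case
  proof (cases "vertices G = {v}")
    case True
    have "edges G = {}"
    proof (rule ccontr)
      assume "edges G \<noteq> {}"
      then obtain e where "e \<subseteq> {v}" "card e = 2" using less.prems(3) True by (auto simp: simple_graph_def)
      then show False using card_mono[of "{v}" e] by simp
    qed
    then show ?thesis using True by simp
  next
    case False
    have lt: "card (vertices G') < card (vertices G)"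
      using v less.prems(1) by (simp add: G'_def card_gt_0_iff less.prems(2))
    have "card (edges G') < card (vertices G')"
    proof (rule less.hyps[OF lt])
      show "finite (vertices G')" "vertices G' \<noteq> {}" using False v less.prems by (auto simp: G'_def)
      show "simple_graph G'" using less.prems(3) by (auto simp: simple_graph_def G'_def)
      show "\<nexists>vs. is_graph_cycle G' vs"
        using less.prems(4) by (auto simp: is_graph_cycle_def G'_def)
    qed
    moreover have "edges G = edges G' \<union> D" by (auto simp: G'_def D_def)
    then have "card (edges G) \<le> card (edges G') + card D" by (simp add: card_Un_le)
    moreover have "card (vertices G') = card (vertices G) - 1"
      using v less.prems(1) by (simp add: G'_def)
    ultimately show ?thesis using \<open>card D \<le> 1\<close> by linarith
  qed
qed

section \<open>Periodic frame and window patterns\<close>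

lemma periodic_int_mult:
  fixes P :: "int \<Rightarrow> 'a"
  assumes "\<And>x. P (x + n) = P x"
  shows "P (x + k * n) = P x"
proof -
  have nat: "P (x + of_nat l * n) = P x" for x l
  proof (induction l)
    case (Suc l)
    then show ?case using assms[of "x + of_nat l * n"] by (simp add: algebra_simps)
  qed simp
  \<comment> \<open>For negative \<open>k\<close>, climb \<open>- k\<close> periods from
    \<open>x + k * n\<close> back to \<open>x\<close>.\<close>
  show ?thesis
    using nat[of x "nat k"] nat[of "x + k * n" "nat (- k)"]
    by (cases "k \<ge> 0") (auto simp: algebra_simps)
qed

text \<open>The predicates say which frames and windows are present. Connectivity is stated dually: every
  two-colouring of the vertices that is constant along the edges is constant.\<close>

locale convex_strip =
  fixes n :: int and E F :: "int \<Rightarrow> bool"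
  assumes n_ge: "n \<ge> 5"
    and E_period: "E (i + n) = E i" and F_period: "F (i + n) = F i"
    and convex: "E i \<Longrightarrow> E (i + 1) \<Longrightarrow> F i"
      "E i \<Longrightarrow> F i \<Longrightarrow> E (i + 1)" "E (i + 1) \<Longrightarrow> F i \<Longrightarrow> E i"
    and connected: "(\<And>i. U (i + n) = U i) \<Longrightarrow> (\<And>i. E i \<Longrightarrow> U i = U (i + 1)) \<Longrightarrow>
      (\<And>i. F i \<Longrightarrow> U i = U (i + 2)) \<Longrightarrow> U i = (U j :: bool)"
begin

section \<open>Cuts and gaps in a convex pattern\<close>

lemma F_shift [simp]: "F (a + n) = F a" "F (a - n) = F a"
  using F_period[of a] F_period[of "a - n"] by auto

text \<open>A colouring only needs to be checked on the block of representatives \<open>a + 1, \<dots>, a + n\<close>.\<close>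

lemma no_cut:
  assumes E1: "\<And>i. 1 \<le> i \<Longrightarrow> i < n \<Longrightarrow> E (a + i) \<Longrightarrow> U i = U (i + 1)"
    and E2: "E (a + n) \<Longrightarrow> U n = U 1"
    and F1: "\<And>i. 1 \<le> i \<Longrightarrow> i < n - 1 \<Longrightarrow> F (a + i) \<Longrightarrow> U i = U (i + 2)"
    and F2: "F (a + (n - 1)) \<Longrightarrow> U (n - 1) = U 1"
    and F3: "F (a + n) \<Longrightarrow> U n = U 2"
  shows "U 1 = (U 2 :: bool)"
proof -
  \<comment> \<open>\<open>r x\<close> is the offset, between 1 and \<open>n\<close>, of the
    representative of \<open>x\<close> in the block after \<open>a\<close>.\<close>
  define r where "r x = (x - a - 1) mod n + 1" for x
  have per: "r (x + n) = r x" for x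
    unfolding r_def by (metis add_diff_eq diff_add_eq mod_add_self2)
  have range: "1 \<le> r x" "r x \<le> n" for x
    unfolding r_def using n_ge pos_mod_sign[of n "x - a - 1"] pos_mod_bound[of n "x - a - 1"] by linarith+
  have r_id: "r (a + i) = i" if "1 \<le> i" "i \<le> n" for i
    unfolding r_def using that by (simp add: mod_pos_pos_trivial)
  have decomp: "\<exists>k. x = a + r x + k * n" for x
    unfolding r_def by (rule exI[of _ "(x - a - 1) div n"]) (simp add: algebra_simps minus_div_mult_eq_mod[symmetric])
  have EE: "E x = E (a + r x)" and FF: "F x = F (a + r x)"
    and RR: "r (x + s) = r (a + r x + s)" for x s
  proof -
    obtain k where k: "x = a + r x + k * n" using decomp by blast
    show "E x = E (a + r x)" using periodic_int_mult[of E n "a + r x" k, OF E_period] k by simp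
    show "F x = F (a + r x)" using periodic_int_mult[of F n "a + r x" k, OF F_period] k by simp
    have "x + s = (a + r x + s) + k * n" using k by simp
    then show "r (x + s) = r (a + r x + s)" using periodic_int_mult[of r n "a + r x + s" k, OF per] by metis
  qed
  \<comment> \<open>Offsets \<open>n + 1\<close> and \<open>n + 2\<close> wrap round to 1 and 2; the
    hypotheses \<open>E2\<close>, \<open>F2\<close> and \<open>F3\<close> are these wrapped
    edges.\<close>
  have r1: "r (a + n + 1) = 1" "r (a + n + 2) = 2"
    using per[of "a + 1"] per[of "a + 2"] r_id[of 1] r_id[of 2] n_ge by (auto simp: algebra_simps)
  have "(U \<circ> r) (a + 1) = (U \<circ> r) (a + 2)"
  proof (rule connected)
    show "(U \<circ> r) (i + n) = (U \<circ> r) i" for i using per by simp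
    show "(U \<circ> r) i = (U \<circ> r) (i + 1)" if "E i" for i
    proof (cases "r i = n")
      case True
      then show ?thesis using E2 EE[of i] that RR[of i 1] r1 by simp
    next
      case False
      then have "r i < n" using range[of i] by simp
      then show ?thesis using E1[of "r i"] EE[of i] that RR[of i 1] r_id[of "r i + 1"] range[of i]
        by (simp add: add.assoc)
    qed
    show "(U \<circ> r) i = (U \<circ> r) (i + 2)" if "F i" for i
    proof -
      consider "r i = n" | "r i = n - 1" | "r i < n - 1" using range[of i] by linarith
      then show ?thesis
      proof cases
        case 1
        then show ?thesis using F3 FF[of i] that RR[of i 2] r1 by simp
      next
        case 2
        then have "a + r i + 2 = a + n + 1" by simp
        then have "r (i + 2) = 1" using RR[of i 2] r1 by metis
        then show ?thesis using 2 F2 FF[of i] that by simp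
      next
        case 3
        then show ?thesis using F1[of "r i"] FF[of i] that RR[of i 2] r_id[of "r i + 2"] range[of i]
          by (simp add: add.assoc)
      qed
    qed
  qed
  then show ?thesis using r_id[of 1] r_id[of 2] n_ge by simp
qed

text \<open>For even \<open>m\<close>, all frames at a + 2, a + 4, ..., a + m are absent, and so are
  f_a and f_{a+m}, the only windows that could leave this set. The set would be cut off from a +
  1.\<close>

lemma gap_length_odd:
  assumes "\<not> F a" "\<not> F (a + m)" and E: "\<And>i. 1 \<le> i \<Longrightarrow> i \<le> m \<Longrightarrow> \<not> E (a + i)"
    and m: "1 \<le> m" "m \<le> n"
  shows "odd m"
proof
  assume "even m"
  then obtain h where h: "m = 2 * h" by blast
  define U where "U y \<longleftrightarrow> even y \<and> y \<le> m" for y :: int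
  have "U 1 = U 2"
  proof (rule no_cut[of a])
    fix i assume "1 \<le> i" "i < n" "E (a + i)"
    then show "U i = U (i + 1)" using E[of i] by (force simp: U_def)
  next
    assume "E (a + n)"
    then show "U n = U 1" using E[of n] m n_ge by (force simp: U_def)
  next
    fix i assume "1 \<le> i" "i < n - 1" "F (a + i)"
    then have "i \<noteq> m" using assms by auto
    then show "U i = U (i + 2)" unfolding U_def h by presburger
  next
    assume "F (a + (n - 1))"
    then have "n - 1 \<noteq> m" using assms by metis
    then show "U (n - 1) = U 1" unfolding U_def using m \<open>even m\<close> by presburger
  next
    assume "F (a + n)"
    then show "U n = U 2" using assms by simp
  qed
  then show False using m \<open>even m\<close> unfolding U_def by presburger
qed

text \<open>In an odd gap, windows join the odd offsets to the left side and the even offsets to the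
  right side. So the stretch between the gaps, with the even offsets of the first gap and the odd
  offsets of the second, has no edge leaving it.\<close>

lemma no_two_gaps:
  assumes "\<not> F a" "\<not> F (a + m)" and E1: "\<And>i. 1 \<le> i \<Longrightarrow> i \<le> m \<Longrightarrow> \<not> E (a + i)"
    and "\<not> F (a + c)" "\<not> F (a + d)" and E2: "\<And>i. c < i \<Longrightarrow> i \<le> d \<Longrightarrow> \<not> E (a + i)"
    and ord: "1 \<le> m" "m \<le> c" "c < d" "d \<le> n"
  shows False
proof -
  have "odd m" using gap_length_odd[of a m] assms by auto
  have "odd (d - c)"
    using gap_length_odd[of "a + c" "d - c"] assms E2[of "c + _"] by (auto simp: algebra_simps)
  \<comment> \<open>the vertices between the two gaps, including the zigzag halves of the gaps attached to them\<close>
  define U where "U y \<longleftrightarrow> y \<le> m \<and> even y \<or> m < y \<and> y \<le> c \<or> c < y \<and> y \<le> d \<and> odd (y - c)" for y :: int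
  have "U 1 = U 2"
  proof (rule no_cut[of a])
    fix i assume i: "1 \<le> i" "i < n" "E (a + i)"
    then have "m < i \<and> i \<le> c \<or> d < i" using E1[of i] E2[of i] by linarith
    then show "U i = U (i + 1)" using ord unfolding U_def by presburger
  next
    assume "E (a + n)"
    then have "d < n" using E2[of n] ord by linarith
    then show "U n = U 1" using ord by (simp add: U_def)
  next
    fix i assume i: "1 \<le> i" "i < n - 1" "F (a + i)"
    then have ne: "i \<noteq> m" "i \<noteq> c" "i \<noteq> d" using assms by auto
    consider "i + 1 = m" | "i + 1 < m" | "m < i" "i < c" | "c < i" "i < d" | "d < i"
      using ne by linarith
    then show "U i = U (i + 2)"
    proof cases
      case 1
      \<comment> \<open>If \<open>m = c\<close>, the middle stretch is empty and this window lands
        on the first odd offset of the second gap.\<close>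
      then have "even i" "i + 2 = m + 1" using \<open>odd m\<close> by auto
      then show ?thesis using 1 ord unfolding U_def by (cases "m = c") auto
    next
      case 4
      then show ?thesis using ord \<open>odd (d - c)\<close> unfolding U_def by presburger
    next
      case 3
      then have "U i" using ord by (simp add: U_def)
      moreover have "U (i + 2)" unfolding U_def using 3 ord by (cases "i + 1 = c") auto
      ultimately show ?thesis by simp
    qed (use ord in \<open>auto simp: U_def\<close>)
  next
    assume "F (a + (n - 1))"
    then have ne: "n - 1 \<noteq> m" "n - 1 \<noteq> c" "n - 1 \<noteq> d" using assms by metis+
    have "\<not> U 1" using ord \<open>odd m\<close> by (auto simp: U_def)
    \<comment> \<open>Either the second gap ends before \<open>n - 1\<close>, or
      \<open>d = n\<close> and \<open>n - 1\<close> has even offset from \<open>c\<close>.\<close>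
    moreover have "m < n - 1" "c < n - 1" "d < n - 1 \<or> d = n" using ne ord by linarith+
    then have "\<not> U (n - 1)" using \<open>odd (d - c)\<close> by (auto simp: U_def)
    ultimately show "U (n - 1) = U 1" by simp
  next
    assume "F (a + n)"
    then show "U n = U 2" using assms by simp
  qed
  then show False using ord \<open>odd m\<close> \<open>odd (d - c)\<close> unfolding U_def by presburger
qed

text \<open>Walk outwards from the absent frame: a present window forces the other frame of its
  triangle to be absent too. The walks stop at absent windows, at the latest at \<open>p\<close> and
  \<open>q\<close>.\<close>

lemma gap_around:
  assumes "\<not> E i" "\<not> F p" "\<not> F q" "p < i" "i \<le> q"
  obtains c d where "p \<le> c" "c < i" "i \<le> d" "d \<le> q" "\<not> F c" "\<not> F d"
    "\<And>x. c < x \<Longrightarrow> x \<le> d \<Longrightarrow> \<not> E x"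
proof -
  have right: "\<exists>d\<ge>i. d \<le> q \<and> \<not> F d \<and> (\<forall>x. i \<le> x \<and> x \<le> d \<longrightarrow> \<not> E x)"
    if "i \<le> q" "\<not> E i" for i using that
  proof (induction "nat (q - i)" arbitrary: i rule: less_induct)
    case less
    show ?case
    proof (cases "F i")
      case True
      then have "i \<noteq> q" using assms by auto
      then obtain d where "d \<ge> i + 1" "d \<le> q" "\<not> F d" "\<forall>x. i + 1 \<le> x \<and> x \<le> d \<longrightarrow> \<not> E x"
        using less.hyps[of "i + 1"] less.prems convex(3)[of i] True by force
      then show ?thesis using less.prems by (intro exI[of _ d]) (metis add1_zle_eq linorder_le_less_linear order_le_less order_trans)
    next
      case False
      then show ?thesis using less.prems by (intro exI[of _ i]) auto
    qed
  qed
  have left: "\<exists>c<i. p \<le> c \<and> \<not> F c \<and> (\<forall>x. c < x \<and> x \<le> i \<longrightarrow> \<not> E x)"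
    if "p < i" "\<not> E i" for i using that
  proof (induction "nat (i - p)" arbitrary: i rule: less_induct)
    case less
    show ?case
    proof (cases "F (i - 1)")
      case True
      then have "i - 1 \<noteq> p" using assms by auto
      then obtain c where "c < i - 1" "p \<le> c" "\<not> F c" "\<forall>x. c < x \<and> x \<le> i - 1 \<longrightarrow> \<not> E x"
        using less.hyps[of "i - 1"] less.prems convex(2)[of "i - 1"] True by force
      then show ?thesis using less.prems by (intro exI[of _ c]) (auto, metis zle_diff1_eq order_le_less)
    next
      case False
      then show ?thesis using less.prems by (intro exI[of _ "i - 1"]) (auto, metis zle_diff1_eq linorder_not_less order_le_less)
    qed
  qed
  show thesis using right[of i] left[of i] assms that by (metis linorder_le_cases)
qed

text \<open>An absent frame elsewhere would create a second gap. Inside the gap parity forbids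
  further absent windows; outside it the frames force the windows to be present.\<close>

lemma determined_by_gap:
  assumes "\<not> F a" "\<not> F (a + m)" and E: "\<And>i. 1 \<le> i \<Longrightarrow> i \<le> m \<Longrightarrow> \<not> E (a + i)"
    and m: "1 \<le> m" "m \<le> n" and i: "1 \<le> i" "i \<le> n"
  shows "E (a + i) \<longleftrightarrow> m < i" "F (a + i) \<longleftrightarrow> i \<noteq> m \<and> i \<noteq> n"
proof -
  have outside: "E (a + i)" if outer: "m < i" "i \<le> n" for i
  proof (rule ccontr)
    assume "\<not> E (a + i)"
    \<comment> \<open>The absent windows f_{a+m} and f_{a+n} = f_a confine the new gap to the
      complement of the given one.\<close>
    then obtain c d where cd: "a + m \<le> c" "c < a + i" "a + i \<le> d" "d \<le> a + n" "\<not> F c" "\<not> F d"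
      "\<And>x. c < x \<Longrightarrow> x \<le> d \<Longrightarrow> \<not> E x"
      by (rule gap_around[of "a + i" "a + m" "a + n"]) (use outer assms in auto)
    show False
      by (rule no_two_gaps[of a m "c - a" "d - a"]) (use assms cd cd(7)[of "a + _"] in auto)
  qed
  show "E (a + i) \<longleftrightarrow> m < i" using outside[of i] E[of i] i by force
  show "F (a + i) \<longleftrightarrow> i \<noteq> m \<and> i \<noteq> n"
  proof
    assume "F (a + i)" then show "i \<noteq> m \<and> i \<noteq> n" using assms by auto
  next
    assume ne: "i \<noteq> m \<and> i \<noteq> n"
    show "F (a + i)"
    proof (cases "i < m")
      case True
      show ?thesis
      proof (rule ccontr)
        assume F: "\<not> F (a + i)"
        \<comment> \<open>An absent window inside the gap splits it into two gaps, both of odd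
          length, although \<open>m\<close> is odd itself.\<close>
        have "odd i" using gap_length_odd[of a i] assms F True by auto
        moreover have "odd (m - i)"
          using gap_length_odd[of "a + i" "m - i"] assms F True E[of "i + _"] by (auto simp: algebra_simps)
        moreover have "odd m" using gap_length_odd[of a m] assms by auto
        ultimately show False by simp
      qed
    next
      case False
      then have "E (a + i)" "E (a + i + 1)"
        using outside[of i] outside[of "i + 1"] ne i by (auto simp: algebra_simps)
      then show ?thesis by (rule convex(1))
    qed
  qed
qed

text \<open>An absent window cannot have both frames of its triangle present; the absent frame then
  extends to a gap within one turn of the cycle.\<close>

lemma exists_gap:
  assumes "\<not> F j"
  obtains a m where "\<not> F a" "\<not> F (a + m)" "\<And>i. 1 \<le> i \<Longrightarrow> i \<le> m \<Longrightarrow> \<not> E (a + i)"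
    "1 \<le> m" "m \<le> n" "odd m"
proof -
  \<comment> \<open>\<open>p\<close> is \<open>j\<close> or \<open>j - n\<close>, chosen so that the
    absent frame lies in the turn from \<open>p\<close> to \<open>p + n\<close>.\<close>
  obtain i p where "\<not> E i" "p < i" "i \<le> p + n" "\<not> F p"
  proof (cases "E j")
    case True
    then have "\<not> E (j + 1)" using convex(1)[of j] assms by blast
    then show thesis using that[of "j + 1" j] assms n_ge by simp
  next
    case False
    then show thesis using that[of j "j - n"] assms n_ge by simp
  qed
  then obtain c d where cd: "p \<le> c" "c < i" "i \<le> d" "d \<le> p + n" "\<not> F c" "\<not> F d"
    "\<And>x. c < x \<Longrightarrow> x \<le> d \<Longrightarrow> \<not> E x"
    using gap_around[of i p "p + n"] by auto
  have gap: "\<not> F c" "\<not> F (c + (d - c))" "\<And>i. 1 \<le> i \<Longrightarrow> i \<le> d - c \<Longrightarrow> \<not> E (c + i)"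
    "1 \<le> d - c" "d - c \<le> n"
    using cd by auto
  then show thesis using that[of c "d - c"] gap_length_odd[OF gap] by blast
qed

text \<open>If all windows are present, each frame forces the next and the previous one. The two
  outcomes are the two trivial graphs.\<close>

lemma no_gap_cases:
  assumes "\<And>i. F i"
  shows "(\<forall>i. E i) \<or> (\<forall>i. \<not> E i) \<and> odd n"
proof (cases "\<exists>i. E i")
  case True
  then obtain i where i: "E i" by blast
  have "E (i + of_nat k)" for k
  proof (induction k)
    case (Suc k)
    then show ?case using convex(2)[of "i + of_nat k"] assms by (simp add: algebra_simps)
  qed (use i in simp)
  moreover have "E (i - of_nat k)" for k
  proof (induction k)
    case (Suc k)
    then show ?case using convex(3)[of "i - of_nat k - 1"] assms by (simp add: algebra_simps)
  qed (use i in simp)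
  ultimately have "E x" for x
    using int_cases2[of "x - i"] by (metis add.commute diff_add_cancel uminus_add_conv_diff)
  then show ?thesis by blast
next
  case False
  have "odd n"
  proof
    assume "even n"
    \<comment> \<open>For even \<open>n\<close>, parity is a periodic colouring, constant along
      windows.\<close>
    have "even (0::int) = even (1::int)"
      by (rule connected[of even 0 1]) (use False \<open>even n\<close> in auto)
    then show False by simp
  qed
  then show ?thesis using False by blast
qed

end

section \<open>Edges of the square cycle\<close>

lemma sc_vertex_eq_iff: "sc_vertex n i = sc_vertex n j \<longleftrightarrow> int n dvd i - j"
  by (simp add: sc_vertex_def mod_eq_dvd_iff)

text \<open>Equality with the endpoints swapped would make \<open>n\<close> divide
  \<open>s + t\<close>, which is at most 4; this is where \<open>n \<ge> 5\<close> enters.\<close>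

lemma edge_eq_iff:
  assumes n: "n \<ge> 5" and st: "s \<in> {1, 2}" "t \<in> {1, 2}"
  shows "{sc_vertex n i, sc_vertex n (i + s)} = {sc_vertex n j, sc_vertex n (j + t)} \<longleftrightarrow>
    s = t \<and> int n dvd i - j"
proof
  assume "{sc_vertex n i, sc_vertex n (i + s)} = {sc_vertex n j, sc_vertex n (j + t)}"
  then consider "int n dvd i - j" "int n dvd i + s - (j + t)" | "int n dvd i - (j + t)" "int n dvd i + s - j"
    by (auto simp: doubleton_eq_iff sc_vertex_eq_iff)
  then show "s = t \<and> int n dvd i - j"
  proof cases
    case 1
    then have "int n dvd s - t" using dvd_diff[OF 1(2,1)] by simp
    then show ?thesis using 1 st n zdvd_not_zless[of "\<bar>s - t\<bar>" "int n"] by auto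
  next
    case 2
    then have "int n dvd s + t" using dvd_diff[OF 2(2,1)] by simp
    then show ?thesis using st n zdvd_not_zless[of "s + t" "int n"] by auto
  qed
next
  assume "s = t \<and> int n dvd i - j"
  then show "{sc_vertex n i, sc_vertex n (i + s)} = {sc_vertex n j, sc_vertex n (j + t)}"
    using sc_vertex_eq_iff[of n i j] sc_vertex_eq_iff[of n "i + s" "j + s"] by simp
qed

lemma
  assumes "n \<ge> 5"
  shows frame_eq_iff: "frame n i = frame n j \<longleftrightarrow> int n dvd i - j"
    and window_eq_iff: "window n i = window n j \<longleftrightarrow> int n dvd i - j"
    and frame_neq_window: "frame n i \<noteq> window n j"
  using edge_eq_iff[OF assms, of 1 1 i j] edge_eq_iff[OF assms, of 2 2 i j]
    edge_eq_iff[OF assms, of 1 2 i j]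
  by (auto simp: frame_def window_def)

lemma edges_square_cycle: "edges (square_cycle n) = range (frame n) \<union> range (window n)"
proof (intro set_eqI iffI)
  fix e assume "e \<in> edges (square_cycle n)"
  then obtain i j where "e = {sc_vertex n i, sc_vertex n j}" "i - j = 1 \<or> i - j = 2"
    by (auto simp: square_cycle_def)
  moreover from this have "i = j + 1 \<or> i = j + 2" by linarith
  ultimately show "e \<in> range (frame n) \<union> range (window n)"
    by (auto simp: frame_def window_def)
next
  fix e assume "e \<in> range (frame n) \<union> range (window n)"
  then obtain i s where "e = {sc_vertex n (i + s), sc_vertex n i}" "s \<in> {1, 2}"
    by (fastforce simp: frame_def window_def)
  moreover from this have "i + s - i \<in> {1, 2}" by simp
  ultimately show "e \<in> edges (square_cycle n)"
    unfolding square_cycle_def by fastforce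
qed

lemma range_frame_window:
  assumes "n \<ge> 5"
  shows "range (frame n) = frame n ` {0..<int n}" "range (window n) = window n ` {0..<int n}"
proof -
  have "frame n x = frame n (x mod int n)" "window n x = window n (x mod int n)"
    "x mod int n \<in> {0..<int n}" for x
    using assms by (simp_all add: frame_eq_iff window_eq_iff mod_eq_dvd_iff[symmetric])
  then have "frame n x \<in> frame n ` {0..<int n}" "window n x \<in> window n ` {0..<int n}" for x
    by blast+
  then show "range (frame n) = frame n ` {0..<int n}" "range (window n) = window n ` {0..<int n}"
    by auto
qed

text \<open>Offsets run from 1 to \<open>n\<close> because the gap of S_{n,k,j} begins with frame
  e_{j+1}; the window f_j then sits at offset \<open>n\<close>.\<close>

lemma exists_residue_in_block:
  assumes "n > 0"
  obtains r where "1 \<le> r" "r \<le> int n" "int n dvd x - (a + r)"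
proof -
  have "int n dvd x - a - 1 - (x - a - 1) mod int n" by (rule dvd_minus_mod)
  then have "int n dvd x - (a + ((x - a - 1) mod int n + 1))" by (simp add: algebra_simps)
  moreover have "(x - a - 1) mod int n \<ge> 0" "(x - a - 1) mod int n < int n" using assms by auto
  ultimately show thesis using that[of "(x - a - 1) mod int n + 1"] by simp
qed

lemma edge_sets_eqI:
  assumes n: "n \<ge> 5" and sub: "A \<subseteq> edges (square_cycle n)" "B \<subseteq> edges (square_cycle n)"
    and fr: "\<And>i. 1 \<le> i \<Longrightarrow> i \<le> int n \<Longrightarrow> frame n (a + i) \<in> A \<longleftrightarrow> frame n (a + i) \<in> B"
    and wi: "\<And>i. 1 \<le> i \<Longrightarrow> i \<le> int n \<Longrightarrow> window n (a + i) \<in> A \<longleftrightarrow> window n (a + i) \<in> B"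
  shows "A = B"
proof -
  have "frame n x \<in> A \<longleftrightarrow> frame n x \<in> B" "window n x \<in> A \<longleftrightarrow> window n x \<in> B" for x
  proof -
    obtain r where r: "1 \<le> r" "r \<le> int n" "int n dvd x - (a + r)"
      using exists_residue_in_block[of n x a] n by auto
    then have "frame n x = frame n (a + r)" "window n x = window n (a + r)"
      using n by (simp_all add: frame_eq_iff window_eq_iff)
    then show "frame n x \<in> A \<longleftrightarrow> frame n x \<in> B" "window n x \<in> A \<longleftrightarrow> window n x \<in> B"
      using fr wi r by auto
  qed
  then show ?thesis using sub unfolding edges_square_cycle by blast
qed

text \<open>The three edges are distinct, so the condition excludes exactly two of them being
  present. The three implications are the \<open>convex\<close> axioms of
  \<open>convex_strip\<close>.\<close>

lemma triangle_condition_iff: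
  assumes n: "n \<ge> 5"
  shows "card (triangle n i \<inter> A) \<le> 1 \<or> triangle n i \<subseteq> A \<longleftrightarrow>
    (frame n i \<in> A \<and> frame n (i + 1) \<in> A \<longrightarrow> window n i \<in> A) \<and>
    (frame n i \<in> A \<and> window n i \<in> A \<longrightarrow> frame n (i + 1) \<in> A) \<and>
    (frame n (i + 1) \<in> A \<and> window n i \<in> A \<longrightarrow> frame n i \<in> A)"
proof -
  have ne: "frame n i \<noteq> frame n (i + 1)" "frame n i \<noteq> window n i" "frame n (i + 1) \<noteq> window n i"
    using n zdvd_not_zless[of 1 "int n"] by (simp_all add: frame_eq_iff frame_neq_window)
  show ?thesis
    by (cases "frame n i \<in> A"; cases "frame n (i + 1) \<in> A"; cases "window n i \<in> A")
       (use ne in \<open>simp_all add: triangle_def Int_insert_left\<close>)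
qed

section \<open>Spanning subgraphs as frame and window patterns\<close>

lemma simple_graph_square_cycle:
  assumes "n \<ge> 5"
  shows "simple_graph (square_cycle n)"
proof -
  have "sc_vertex n i \<noteq> sc_vertex n (i + s)" if "s \<in> {1, 2}" for i s
    using that assms zdvd_not_zless[of s "int n"] by (auto simp: sc_vertex_eq_iff)
  then have "card (frame n i) = 2" "card (window n i) = 2" for i
    by (simp_all add: frame_def window_def)
  moreover have "sc_vertex n i \<in> {0..<int n}" for i
    using assms by (simp add: sc_vertex_def)
  ultimately show ?thesis
    unfolding simple_graph_def edges_square_cycle
    by (auto simp: square_cycle_def frame_def window_def)
qed

lemma vertices_square_cycle [simp]: "vertices (square_cycle n) = {0..<int n}"
  by (simp add: square_cycle_def)

lemma spanning_subgraph_iff: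
  assumes "n \<ge> 5"
  shows "is_spanning_subgraph H (square_cycle n) \<longleftrightarrow>
    vertices H = {0..<int n} \<and> edges H \<subseteq> edges (square_cycle n)"
  using simple_graph_square_cycle[OF assms]
  by (auto simp: is_spanning_subgraph_def is_subgraph_def simple_graph_def)

lemma convex_subgraph_iff:
  assumes "n \<ge> 5" "is_spanning_subgraph H (square_cycle n)"
  shows "convex_subgraph n H \<longleftrightarrow> (\<forall>i.
    (frame n i \<in> edges H \<and> frame n (i + 1) \<in> edges H \<longrightarrow> window n i \<in> edges H) \<and>
    (frame n i \<in> edges H \<and> window n i \<in> edges H \<longrightarrow> frame n (i + 1) \<in> edges H) \<and>
    (frame n (i + 1) \<in> edges H \<and> window n i \<in> edges H \<longrightarrow> frame n i \<in> edges H))"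
  using assms(2) unfolding convex_subgraph_def triangle_condition_iff[OF assms(1)]
  by (simp add: is_spanning_subgraph_def)

lemma connected_graph_mono:
  assumes "connected_graph G" "vertices G = vertices H" "edges G \<subseteq> edges H"
  shows "connected_graph H"
proof -
  have "(adjacency G)\<^sup>* \<subseteq> (adjacency H)\<^sup>*"
    using assms(3) by (intro rtrancl_mono) (auto simp: adjacency_def)
  then show ?thesis using assms(1,2) unfolding connected_graph_def by blast
qed

text \<open>The colouring axiom holds because a colouring constant along edges is constant along
  walks.\<close>

lemma convex_strip_of_graph:
  assumes n: "n \<ge> 5" and H: "is_spanning_subgraph H (square_cycle n)" "convex_subgraph n H"
    "connected_graph H"
  shows "convex_strip (int n) (\<lambda>i. frame n i \<in> edges H) (\<lambda>i. window n i \<in> edges H)"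
proof
  show "5 \<le> int n" using n by simp
  fix i :: int
  have "frame n (i + int n) = frame n i" "window n (i + int n) = window n i"
    using n by (simp_all add: frame_eq_iff window_eq_iff)
  then show "(frame n (i + int n) \<in> edges H) = (frame n i \<in> edges H)"
    "(window n (i + int n) \<in> edges H) = (window n i \<in> edges H)" by simp_all
  note conv = H(2)[unfolded convex_subgraph_iff[OF n H(1)], rule_format]
  show "window n i \<in> edges H" if "frame n i \<in> edges H" "frame n (i + 1) \<in> edges H"
    using conv[of i] that by blast
  show "frame n (i + 1) \<in> edges H" if "frame n i \<in> edges H" "window n i \<in> edges H"
    using conv[of i] that by blast
  show "frame n i \<in> edges H" if "frame n (i + 1) \<in> edges H" "window n i \<in> edges H"
    using conv[of i] that by blast
next
  fix U :: "int \<Rightarrow> bool" and i j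
  assume per: "\<And>i. U (i + int n) = U i"
    and fr: "\<And>i. frame n i \<in> edges H \<Longrightarrow> U i = U (i + 1)"
    and wi: "\<And>i. window n i \<in> edges H \<Longrightarrow> U i = U (i + 2)"
  \<comment> \<open>Periodicity turns a colouring of the integers into a colouring of the
    vertices.\<close>
  have "U (x + k * int n) = U x" for x k by (rule periodic_int_mult[of U, OF per])
  then have U_vertex: "U (sc_vertex n x) = U x" for x
    unfolding sc_vertex_def by (metis mod_div_mult_eq)
  have step: "U u = U v" if "{u, v} \<in> edges H" for u v
  proof -
    have "{u, v} \<in> range (frame n) \<union> range (window n)"
      using that H(1) unfolding edges_square_cycle[symmetric]
      by (auto simp: is_spanning_subgraph_def is_subgraph_def)
    then consider x where "{u, v} = frame n x" | x where "{u, v} = window n x" by blast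
    then show ?thesis
    proof cases
      case 1
      then show ?thesis using fr[of x] that U_vertex[of x] U_vertex[of "x + 1"]
        by (auto simp: frame_def doubleton_eq_iff insert_commute)
    next
      case 2
      then show ?thesis using wi[of x] that U_vertex[of x] U_vertex[of "x + 2"]
        by (auto simp: window_def doubleton_eq_iff insert_commute)
    qed
  qed
  have "(sc_vertex n i, sc_vertex n j) \<in> (adjacency H)\<^sup>*"
    using H(1,3) n by (auto simp: connected_graph_def spanning_subgraph_iff sc_vertex_def)
  then have "U (sc_vertex n i) = U (sc_vertex n j)"
    by (induction rule: rtrancl_induct) (use step in \<open>auto simp: adjacency_def\<close>)
  then show "U i = U j" by (simp add: U_vertex)
qed

section \<open>The graphs $S_{n,k,j}$\<close>

lemma dvd_diff_iff_eq:
  assumes "\<bar>x - y\<bar> < int n"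
  shows "int n dvd x - y \<longleftrightarrow> x = y"
  using assms dvd_imp_le_int[of "x - y" "int n"] by auto

text \<open>This is the pattern of \<open>determined_by_gap\<close> with
  \<open>m = 2 * k + 1\<close>. If \<open>2 * k + 1 = n\<close>, the two removed windows
  coincide.\<close>

lemma S_graph_edges_iff:
  assumes n: "n \<ge> 5" and k: "0 \<le> k" "2 * k + 1 \<le> int n" and i: "1 \<le> i" "i \<le> int n"
  shows "frame n (j + i) \<in> edges (S_graph n k j) \<longleftrightarrow> 2 * k + 1 < i"
    and "window n (j + i) \<in> edges (S_graph n k j) \<longleftrightarrow> i \<noteq> 2 * k + 1 \<and> i \<noteq> int n"
proof -
  have "(\<exists>x\<in>{j + 1..j + 2 * k + 1}. int n dvd j + i - x) \<longleftrightarrow> i \<le> 2 * k + 1"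
  proof
    assume "\<exists>x\<in>{j + 1..j + 2 * k + 1}. int n dvd j + i - x"
    then obtain x where x: "x \<in> {j + 1..j + 2 * k + 1}" "int n dvd j + i - x" by blast
    then have "j + i = x" using dvd_diff_iff_eq[of "j + i" x n] i k by auto
    then show "i \<le> 2 * k + 1" using x by auto
  next
    assume "i \<le> 2 * k + 1"
    then show "\<exists>x\<in>{j + 1..j + 2 * k + 1}. int n dvd j + i - x"
      using i by (intro bexI[of _ "j + i"]) auto
  qed
  then show "frame n (j + i) \<in> edges (S_graph n k j) \<longleftrightarrow> 2 * k + 1 < i"
    using n by (auto simp: S_graph_def edges_square_cycle frame_neq_window image_iff frame_eq_iff
        intro: exI[of _ "j + i"])
  have "int n dvd i \<longleftrightarrow> i = int n" using i zdvd_imp_le[of "int n" i] by auto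
  moreover have "int n dvd i - (2 * k + 1) \<longleftrightarrow> i = 2 * k + 1"
    using i k by (intro dvd_diff_iff_eq) auto
  ultimately show "window n (j + i) \<in> edges (S_graph n k j) \<longleftrightarrow> i \<noteq> 2 * k + 1 \<and> i \<noteq> int n"
    using n by (auto simp: S_graph_def edges_square_cycle frame_neq_window[symmetric] window_eq_iff algebra_simps)
qed

lemma S_graph_spanning:
  assumes "n \<ge> 5"
  shows "is_spanning_subgraph (S_graph n k j) (square_cycle n)"
  unfolding spanning_subgraph_iff[OF assms] by (auto simp: S_graph_def)

lemma S_graph_convex:
  assumes n: "n \<ge> 5" and k: "0 \<le> k" "2 * k + 1 \<le> int n"
  shows "convex_subgraph n (S_graph n k j)"
  unfolding convex_subgraph_iff[OF n S_graph_spanning[OF n]]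
proof
  fix x
  obtain i where i: "1 \<le> i" "i \<le> int n" "int n dvd x - (j + i)"
    using exists_residue_in_block[of n x j] n by auto
  then have x: "frame n x = frame n (j + i)" "window n x = window n (j + i)"
    "frame n (x + 1) = frame n (j + i + 1)"
    using n by (simp_all add: frame_eq_iff window_eq_iff)
  show "(frame n x \<in> edges (S_graph n k j) \<and> frame n (x + 1) \<in> edges (S_graph n k j) \<longrightarrow>
        window n x \<in> edges (S_graph n k j)) \<and>
      (frame n x \<in> edges (S_graph n k j) \<and> window n x \<in> edges (S_graph n k j) \<longrightarrow>
        frame n (x + 1) \<in> edges (S_graph n k j)) \<and>
      (frame n (x + 1) \<in> edges (S_graph n k j) \<and> window n x \<in> edges (S_graph n k j) \<longrightarrow>
        frame n x \<in> edges (S_graph n k j))"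
  proof (cases "i = int n")
    case True
    \<comment> \<open>At offset \<open>n\<close> the second frame of the triangle wraps round to the
      first frame of the gap.\<close>
    then have "frame n (x + 1) = frame n (j + 1)"
      using n x(3) dvd_add[OF i(3) dvd_refl[of "int n"]] by (simp add: frame_eq_iff algebra_simps)
    then show ?thesis
      using S_graph_edges_iff[OF n k i(1,2), of j] S_graph_edges_iff[OF n k, of 1 j] k i x True by simp
  next
    case False
    then show ?thesis
      using S_graph_edges_iff[OF n k i(1,2), of j] S_graph_edges_iff[OF n k, of "i + 1" j] i k x
      by (auto simp: add.assoc)
  qed
qed

text \<open>Both trivial graphs contain every window, whereas f_j is absent here.\<close>

lemma S_graph_nontrivial:
  assumes n: "n \<ge> 5" and k: "0 \<le> k" "2 * k + 1 \<le> int n"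
  shows "\<not> trivial_subgraph n (S_graph n k j)"
proof
  assume "trivial_subgraph n (S_graph n k j)"
  then have "window n (j mod int n) \<in> edges (S_graph n k j)"
    using n unfolding trivial_subgraph_def by (auto simp: edges_square_cycle)
  moreover have "window n (j mod int n) = window n (j + int n)"
    using n by (simp add: window_eq_iff mod_eq_dvd_iff[symmetric])
  ultimately show False using S_graph_edges_iff(2)[OF n k, of "int n" j] n by simp
qed

lemma ugraph_eqI: "vertices G = vertices H \<Longrightarrow> edges G = edges H \<Longrightarrow> G = (H :: 'a ugraph)"
  by simp

text \<open>One gap determines the whole pattern of \<open>H\<close>, so it suffices to compare it
  with that of S_{n,k,j} on one block.\<close>

lemma eq_S_graph_if_gap:
  assumes n: "n \<ge> 5" and H: "is_spanning_subgraph H (square_cycle n)" "convex_subgraph n H"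
    "connected_graph H" and k: "0 \<le> k" "2 * k + 1 \<le> int n"
    and gap: "window n j \<notin> edges H" "window n (j + (2 * k + 1)) \<notin> edges H"
      "\<And>i. 1 \<le> i \<Longrightarrow> i \<le> 2 * k + 1 \<Longrightarrow> frame n (j + i) \<notin> edges H"
  shows "H = S_graph n k j"
proof (rule ugraph_eqI)
  interpret convex_strip "int n" "\<lambda>i. frame n i \<in> edges H" "\<lambda>i. window n i \<in> edges H"
    by (rule convex_strip_of_graph[OF n H])
  show "vertices H = vertices (S_graph n k j)"
    using H(1) by (simp add: spanning_subgraph_iff[OF n] S_graph_def)
  show "edges H = edges (S_graph n k j)"
  proof (rule edge_sets_eqI[OF n, where a = j])
    show "edges H \<subseteq> edges (square_cycle n)" "edges (S_graph n k j) \<subseteq> edges (square_cycle n)"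
      using H(1) S_graph_spanning[OF n] by (auto simp: spanning_subgraph_iff[OF n])
    fix i assume i: "1 \<le> i" "i \<le> int n"
    show "frame n (j + i) \<in> edges H \<longleftrightarrow> frame n (j + i) \<in> edges (S_graph n k j)"
      "window n (j + i) \<in> edges H \<longleftrightarrow> window n (j + i) \<in> edges (S_graph n k j)"
      using determined_by_gap[OF gap _ k(2) i] k S_graph_edges_iff[OF n k i, of j] by simp_all
  qed
qed

text \<open>A subgraph inherits the gap. Thus S_{n,k,j} has no proper connected spanning convex
  subgraph.\<close>

lemma eq_S_graph_if_subset:
  assumes n: "n \<ge> 5" and H: "is_spanning_subgraph H (square_cycle n)" "convex_subgraph n H"
    "connected_graph H" and k: "0 \<le> k" "2 * k + 1 \<le> int n"
    and sub: "edges H \<subseteq> edges (S_graph n k j)"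
  shows "H = S_graph n k j"
proof (rule eq_S_graph_if_gap[OF n H k])
  have "window n j = window n (j + int n)" using n by (simp add: window_eq_iff)
  then show "window n j \<notin> edges H" using S_graph_edges_iff(2)[OF n k, of "int n" j] n sub by auto
  show "window n (j + (2 * k + 1)) \<notin> edges H"
    using S_graph_edges_iff(2)[OF n k, of "2 * k + 1" j] k sub by auto
  show "frame n (j + i) \<notin> edges H" if "1 \<le> i" "i \<le> 2 * k + 1" for i
    using S_graph_edges_iff(1)[OF n k, of i j] k sub that by auto
qed

section \<open>Classification and uniqueness of nontrivial convex graphs\<close>

lemma S_graph_mod:
  assumes "n \<ge> 5"
  shows "S_graph n k (j mod int n) = S_graph n k j"
proof -
  have d: "int n dvd j mod int n - j" by (simp add: mod_eq_dvd_iff[symmetric])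
  have sh: "frame n (j mod int n + x) = frame n (j + x)" "window n (j mod int n + x) = window n (j + x)" for x
    using d assms by (simp_all add: frame_eq_iff window_eq_iff)
  have "frame n ` {a + 1..a + 2 * k + 1} = (\<lambda>x. frame n (a + x)) ` {1..2 * k + 1}" for a
    using image_image[of "frame n" "\<lambda>x. a + x" "{1..2 * k + 1}"]
    by (simp add: add.commute add.left_commute)
  then show ?thesis using sh(1) sh(2)[of 0] sh(2)[of "2 * k + 1"]
    by (simp add: S_graph_def add.assoc)
qed

text \<open>With every window present \<open>H\<close> would be trivial; otherwise an absent window
  yields an odd gap, which determines \<open>H\<close>.\<close>

lemma nontrivial_convex_is_S_graph:
  assumes n: "n \<ge> 5" and H: "is_spanning_subgraph H (square_cycle n)" "convex_subgraph n H"
    "connected_graph H" "\<not> trivial_subgraph n H"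
  obtains k j where "0 \<le> k" "2 * k + 1 \<le> int n" "0 \<le> j" "j < int n" "H = S_graph n k j"
proof -
  interpret convex_strip "int n" "\<lambda>i. frame n i \<in> edges H" "\<lambda>i. window n i \<in> edges H"
    by (rule convex_strip_of_graph[OF n H(1-3)])
  have vert: "vertices H = {0..<int n}" and sub: "edges H \<subseteq> edges (square_cycle n)"
    using H(1) by (simp_all add: spanning_subgraph_iff[OF n])
  have "\<exists>i. window n i \<notin> edges H"
  proof (rule ccontr)
    assume "\<not> ?thesis"
    then have all: "window n i \<in> edges H" for i by blast
    then consider "\<forall>i. frame n i \<in> edges H" | "\<forall>i. frame n i \<notin> edges H" "odd n"
      using no_gap_cases by auto
    then show False
    proof cases
      case 1
      then have "edges H = edges (square_cycle n)" using all sub by (auto simp: edges_square_cycle)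
      then have "H = square_cycle n" using vert by (intro ugraph_eqI) auto
      then show False using H(4) by (simp add: trivial_subgraph_def)
    next
      case 2
      have "{0..int n - 1} = {0..<int n}" by auto
      then have "range (window n) = window n ` {0..int n - 1}" using range_frame_window[OF n] by simp
      moreover have "edges H = range (window n)" using 2 all sub by (auto simp: edges_square_cycle)
      ultimately have "H = \<lparr>vertices = {0..<int n}, edges = window n ` {0..int n - 1}\<rparr>"
        using vert by (intro ugraph_eqI) auto
      then show False using H(4) 2 by (simp add: trivial_subgraph_def)
    qed
  qed
  then obtain i where "window n i \<notin> edges H" by blast
  from exists_gap[OF this] obtain a m where gap: "window n a \<notin> edges H" "window n (a + m) \<notin> edges H"
    "\<And>i. 1 \<le> i \<Longrightarrow> i \<le> m \<Longrightarrow> frame n (a + i) \<notin> edges H" "1 \<le> m" "m \<le> int n" "odd m"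
    by metis
  from \<open>odd m\<close> obtain k where k: "m = 2 * k + 1" by (elim oddE)
  have "H = S_graph n k a"
    by (rule eq_S_graph_if_gap[OF n H(1-3)]) (use gap k in auto)
  then have "H = S_graph n k (a mod int n)" using S_graph_mod[OF n] by simp
  then show thesis using that[of k "a mod int n"] gap k n by simp
qed

text \<open>If some frame is present, e_j is the only present frame followed by an absent one, and
  the number of absent frames gives \<open>k\<close>. If there are no frames, \<open>k\<close> is
  fixed by \<open>n\<close> and \<open>j\<close> is read off from the single absent window.\<close>

lemma S_graph_inj:
  assumes n: "n \<ge> 5" and k: "0 \<le> k" "2 * k + 1 \<le> int n" and k': "0 \<le> k'" "2 * k' + 1 \<le> int n"
    and j: "0 \<le> j" "j < int n" "0 \<le> j'" "j' < int n"
    and eq: "S_graph n k j = S_graph n k' j'"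
  shows "k = k' \<and> j = j'"
proof -
  have dvd_j: "j = j'" if "int n dvd j - j'" using that j dvd_diff_iff_eq[of j j' n] by auto
  have full: "frame n x \<in> edges (S_graph n l i) \<Longrightarrow> 2 * l + 1 < int n"
    if "0 \<le> l" "2 * l + 1 \<le> int n" for l i x
  proof -
    obtain r where r: "1 \<le> r" "r \<le> int n" "int n dvd x - (i + r)"
      using exists_residue_in_block[of n x i] n by auto
    moreover from this have "frame n x = frame n (i + r)" using n by (simp add: frame_eq_iff)
    ultimately show "frame n x \<in> edges (S_graph n l i) \<Longrightarrow> 2 * l + 1 < int n"
      using S_graph_edges_iff(1)[OF n that r(1,2), of i] by simp
  qed
  have last: "frame n (i + int n) \<in> edges (S_graph n l i) \<longleftrightarrow> 2 * l + 1 < int n"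
    if "0 \<le> l" "2 * l + 1 \<le> int n" for l i
    using S_graph_edges_iff(1)[OF n that, of "int n" i] n by simp
  \<comment> \<open>Both cases aim at \<open>r = int n\<close>, which says that \<open>j\<close> and
    \<open>j'\<close> agree modulo \<open>n\<close>.\<close>
  obtain r where r: "1 \<le> r" "r \<le> int n" "int n dvd j - (j' + r)"
    using exists_residue_in_block[of n j j'] n by auto
  have fr: "frame n (j + x) = frame n (j' + (r + x))" "window n (j + x) = window n (j' + (r + x))" for x
    using r n by (simp_all add: frame_eq_iff window_eq_iff algebra_simps)
  show ?thesis
  proof (cases "2 * k + 1 = int n")
    case True
    then have "\<not> 2 * k' + 1 < int n" using full[OF k, where x = "j' + int n" and i = j] last[OF k', of j'] True
      unfolding eq by linarith
    then have k'n: "2 * k' + 1 = int n" using k' by simp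
    have "window n (j' + r) \<notin> edges (S_graph n k' j')"
      using S_graph_edges_iff(2)[OF n k, of "int n" j] fr(2)[of 0] window_eq_iff[OF n, of "j + int n" j] n eq
      by simp
    then have "r = 2 * k' + 1 \<or> r = int n" using S_graph_edges_iff(2)[OF n k' r(1,2), of j'] by blast
    then have "r = int n" using k'n by auto
    then have "j = j'" using dvd_j r dvd_add[OF r(3) dvd_refl[of "int n"]] by (simp add: algebra_simps)
    moreover have "k = k'" using True k'n by linarith
    ultimately show ?thesis by simp
  next
    case False
    then have lt: "2 * k + 1 < int n" using k by simp
    then have lt': "2 * k' + 1 < int n" using full[OF k'] last[OF k, of j] eq by metis
    have "frame n (j + int n) = frame n j" using n by (simp add: frame_eq_iff)
    then have "frame n (j' + r) = frame n (j + int n)" using fr(1)[of 0] by simp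
    then have "2 * k' + 1 < r" using last[OF k, of j] lt eq S_graph_edges_iff(1)[OF n k' r(1,2), of j'] by simp
    moreover have "frame n (j' + (r + 1)) \<notin> edges (S_graph n k' j')"
      using S_graph_edges_iff(1)[OF n k, of 1 j] fr(1)[of 1] k eq n by simp
    ultimately have "r = int n" using S_graph_edges_iff(1)[OF n k', of "r + 1" j'] r by force
    then have jj: "j = j'" using dvd_j dvd_add[OF r(3) dvd_refl[of "int n"]] by (simp add: algebra_simps)
    \<comment> \<open>Offset \<open>2 * k + 2\<close> carries the first present frame after the gap
      of length \<open>2 * k + 1\<close>.\<close>
    have "2 * k' + 1 < 2 * k + 2"
      using S_graph_edges_iff(1)[OF n k, of "2 * k + 2" j] S_graph_edges_iff(1)[OF n k', of "2 * k + 2" j] eq jj lt k by simp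
    moreover have "2 * k + 1 < 2 * k' + 2"
      using S_graph_edges_iff(1)[OF n k, of "2 * k' + 2" j] S_graph_edges_iff(1)[OF n k', of "2 * k' + 2" j] eq jj lt' k' by simp
    ultimately show ?thesis using jj by simp
  qed
qed

text \<open>The triangle implications pass to the intersection, which is connected because it
  contains \<open>G\<close>; minimality of the graphs S_{n,k,j} makes it equal to both
  \<open>H\<close> and \<open>H'\<close>.\<close>

lemma nontrivial_convex_unique:
  assumes n: "n \<ge> 5" and G: "vertices G = {0..<int n}" "connected_graph G"
    and H: "is_spanning_subgraph H (square_cycle n)" "convex_subgraph n H"
      "\<not> trivial_subgraph n H" "edges G \<subseteq> edges H"
    and H': "is_spanning_subgraph H' (square_cycle n)" "convex_subgraph n H'"
      "\<not> trivial_subgraph n H'" "edges G \<subseteq> edges H'"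
  shows "H = H'"
proof -
  define I where "I = \<lparr>vertices = {0..<int n}, edges = edges H \<inter> edges H'\<rparr>"
  have I1: "is_spanning_subgraph I (square_cycle n)"
    using H(1) by (auto simp: spanning_subgraph_iff[OF n] I_def)
  have I2: "convex_subgraph n I"
    using H(2) H'(2) unfolding convex_subgraph_iff[OF n I1] convex_subgraph_iff[OF n H(1)]
      convex_subgraph_iff[OF n H'(1)] unfolding I_def ugraph.select_convs Int_iff by blast
  have I3: "connected_graph I"
    by (rule connected_graph_mono[OF G(2)]) (use G H(4) H'(4) in \<open>auto simp: I_def\<close>)
  have *: "I = K" if K: "is_spanning_subgraph K (square_cycle n)" "convex_subgraph n K"
    "\<not> trivial_subgraph n K" "edges G \<subseteq> edges K" "edges I \<subseteq> edges K" for K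
  proof -
    have "connected_graph K"
      by (rule connected_graph_mono[OF G(2)]) (use G K in \<open>auto simp: spanning_subgraph_iff[OF n]\<close>)
    then obtain k j where "0 \<le> k" "2 * k + 1 \<le> int n" "K = S_graph n k j"
      using nontrivial_convex_is_S_graph[OF n K(1,2) _ K(3)] by metis
    then show ?thesis using eq_S_graph_if_subset[OF n I1 I2 I3] K(5) by simp
  qed
  have "edges I \<subseteq> edges H" "edges I \<subseteq> edges H'" by (auto simp: I_def)
  then have "I = H" "I = H'" using *[OF H] *[OF H'] by blast+
  then show ?thesis by simp
qed

section \<open>Spanning trees\<close>

lemma
  assumes "n \<ge> 5"
  shows inj_on_frame: "inj_on (frame n) {0..<int n}"
    and inj_on_window: "inj_on (window n) {0..<int n}"
  using assms dvd_diff_iff_eq[of _ _ n] by (auto simp: inj_on_def frame_eq_iff window_eq_iff)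

lemma card_edges_square_cycle:
  assumes "n \<ge> 5"
  shows "finite (edges (square_cycle n))" "card (edges (square_cycle n)) = 2 * n"
proof -
  show "finite (edges (square_cycle n))"
    by (simp add: edges_square_cycle range_frame_window[OF assms])
  have "frame n ` {0..<int n} \<inter> window n ` {0..<int n} = {}"
    using frame_neq_window[OF assms] by auto
  then show "card (edges (square_cycle n)) = 2 * n"
    by (simp add: edges_square_cycle range_frame_window[OF assms] card_Un_disjoint
        card_image inj_on_frame[OF assms] inj_on_window[OF assms])
qed

text \<open>An extremal choice replaces the iterated closure: a largest set with the counting bound
  must be closed, since adding an edge that completes a triangle would preserve the bound.\<close>

lemma exists_nontrivial_convex:
  assumes n: "n \<ge> 5" and G: "is_spanning_tree G (square_cycle n)"
  obtains H where "is_spanning_subgraph H (square_cycle n)" "convex_subgraph n H"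
    "connected_graph H" "\<not> trivial_subgraph n H" "edges G \<subseteq> edges H"
proof -
  let ?E = "edges (square_cycle n)"
  define t where "t A = {i \<in> {0..<int n}. triangle n i \<subseteq> A}" for A
  \<comment> \<open>the bound kept by triangle completion; a largest set satisfying it is closed\<close>
  define P where "P A \<longleftrightarrow> edges G \<subseteq> A \<and> A \<subseteq> ?E \<and> card A \<le> card (edges G) + card (t A)" for A
  note finE = card_edges_square_cycle(1)[OF n]
  have vert: "vertices G = {0..<int n}" and subG: "edges G \<subseteq> ?E" and conn: "connected_graph G"
    using G spanning_subgraph_iff[OF n] by (auto simp: is_spanning_tree_def is_tree_def)
  have card_G: "card (edges G) < n"
    using card_edges_less_card_vertices[of G] G vert n
    by (auto simp: is_spanning_tree_def is_tree_def)
  have "P (edges G)" using subG by (simp add: P_def)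
  moreover have "\<forall>A. P A \<longrightarrow> card A < Suc (card ?E)"
    by (auto simp: P_def less_Suc_eq_le intro: card_mono[OF finE])
  ultimately have "\<exists>A. P A \<and> (\<forall>B. P B \<longrightarrow> card B \<le> card A)"
    by (rule ex_has_greatest_nat[of P "edges G" card])
  then obtain A where A: "P A" and greatest: "\<And>B. P B \<Longrightarrow> card B \<le> card A" by blast
  have finA: "finite A" using A finE finite_subset by (auto simp: P_def)
  define H where "H = \<lparr>vertices = {0..<int n}, edges = A\<rparr>"
  have H: "is_spanning_subgraph H (square_cycle n)"
    using A by (simp add: spanning_subgraph_iff[OF n] H_def P_def)
  have fin_t: "finite (t B)" for B unfolding t_def by (rule finite_subset[of _ "{0..<int n}"]) auto
  have triangle_sub: "triangle n x \<subseteq> ?E" for x by (auto simp: triangle_def edges_square_cycle)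
  have complete: "e \<in> A" if e: "e \<in> triangle n x" "triangle n x - {e} \<subseteq> A" for e x
  proof (rule ccontr)
    assume "e \<notin> A"
    \<comment> \<open>\<open>t\<close> counts triangles by indices in \<open>{0..<int n}\<close>, so
      \<open>x\<close> is replaced by its residue.\<close>
    define i where "i = x mod int n"
    have "int n dvd i - x" by (simp add: i_def mod_eq_dvd_iff[symmetric])
    then have "frame n i = frame n x" "frame n (i + 1) = frame n (x + 1)" "window n i = window n x"
      using n by (simp_all add: frame_eq_iff window_eq_iff)
    then have tri: "triangle n i = triangle n x" by (simp add: triangle_def)
    have i: "i \<in> {0..<int n}" using n by (simp add: i_def)
    have "t A \<subseteq> t (insert e A)" "i \<in> t (insert e A)" "i \<notin> t A"
      using e \<open>e \<notin> A\<close> i tri by (auto simp: t_def)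
    then have "card (t A) < card (t (insert e A))"
      by (intro psubset_card_mono fin_t) blast
    then have "P (insert e A)"
      using A e \<open>e \<notin> A\<close> finA triangle_sub by (auto simp: P_def)
    then show False using greatest \<open>e \<notin> A\<close> finA by fastforce
  qed
  have "convex_subgraph n H"
    unfolding convex_subgraph_iff[OF n H] using complete by (auto simp: triangle_def H_def)
  moreover have "connected_graph H"
    by (rule connected_graph_mono[OF conn]) (use A vert in \<open>auto simp: P_def H_def\<close>)
  moreover have "\<not> trivial_subgraph n H"
  proof
    assume "trivial_subgraph n H"
    moreover have "{0..int n - 1} = {0..<int n}" by auto
    ultimately consider "A = ?E" | "A = window n ` {0..<int n}"
      by (metis H_def trivial_subgraph_def ugraph.select_convs(2))
    then show False
    proof cases
      case 1
      \<comment> \<open>The whole graph has 2n edges, but the bound allows fewer than n + n.\<close>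
      have "t A \<subseteq> {0..<int n}" by (auto simp: t_def)
      then have "card (t A) \<le> n" using card_mono[of "{0..<int n}" "t A"] by simp
      then show False using A 1 card_G card_edges_square_cycle(2)[OF n] by (simp add: P_def)
    next
      case 2
      \<comment> \<open>The window graph contains no full triangle, so the bound leaves fewer than n
        edges.\<close>
      have "t A = {}" using frame_neq_window[OF n] by (auto simp: 2 t_def triangle_def)
      moreover have "card A = n" by (simp add: 2 card_image inj_on_window[OF n])
      ultimately show False using A card_G by (simp add: P_def)
    qed
  qed
  ultimately show thesis using that[of H] H A by (simp add: P_def H_def)
qed

text \<open>By integrality both sides mean 2k < n: the range of \<open>k\<close> says that a gap of
  length 2k + 1 fits into one turn.\<close>

lemma le_ceiling_half_iff: "k \<le> \<lceil>(real n - 2) / 2\<rceil> \<longleftrightarrow> 2 * k + 1 \<le> int n"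
proof -
  have "k \<le> \<lceil>(real n - 2) / 2\<rceil> \<longleftrightarrow> real_of_int (2 * k) < real_of_int (int n)"
    by (simp add: le_ceiling_iff field_simps)
  also have "\<dots> \<longleftrightarrow> 2 * k + 1 \<le> int n" by (simp only: of_int_less_iff) linarith
  finally show ?thesis .
qed

section \<open>Decomposition of the spanning trees\<close>

lemma spanning_tree_S_graph_iff:
  assumes "n \<ge> 5"
  shows "is_spanning_tree G (S_graph n k j) \<longleftrightarrow>
    is_spanning_tree G (square_cycle n) \<and> edges G \<subseteq> edges (S_graph n k j)"
  by (auto simp: is_spanning_tree_def is_spanning_subgraph_def is_subgraph_def S_graph_def)

theorem theorem4p1:
  fixes n :: nat
  assumes "n \<ge> 5"
  shows "(\<forall>G. is_spanning_tree G (square_cycle n) \<longrightarrow>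
            (\<exists>!H. is_spanning_subgraph H (square_cycle n) \<and> convex_subgraph n H \<and>
                  connected_graph H \<and> \<not> trivial_subgraph n H \<and> edges G \<subseteq> edges H))
       \<and> spanning_trees (square_cycle n) =
           (\<Union>k\<in>{0..\<lceil>(real n - 2) / 2\<rceil>}. \<Union>j\<in>{0..int n - 1}. spanning_trees (S_graph n k j))
       \<and> disjoint_family_on (\<lambda>(k, j). spanning_trees (S_graph n k j))
           ({0..\<lceil>(real n - 2) / 2\<rceil>} \<times> {0..int n - 1})"
proof (intro conjI allI impI)
  note n = assms
  have tree: "vertices G = {0..<int n}" "connected_graph G" if "is_spanning_tree G (square_cycle n)" for G
    using that by (auto simp: is_spanning_tree_def is_tree_def spanning_subgraph_iff[OF n])
  fix G assume G: "is_spanning_tree G (square_cycle n)"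
  show "\<exists>!H. is_spanning_subgraph H (square_cycle n) \<and> convex_subgraph n H \<and>
      connected_graph H \<and> \<not> trivial_subgraph n H \<and> edges G \<subseteq> edges H"
  proof (rule ex_ex1I)
    show "\<exists>H. is_spanning_subgraph H (square_cycle n) \<and> convex_subgraph n H \<and>
      connected_graph H \<and> \<not> trivial_subgraph n H \<and> edges G \<subseteq> edges H"
      using exists_nontrivial_convex[OF n G] by metis
  next
    fix H H'
    assume "is_spanning_subgraph H (square_cycle n) \<and> convex_subgraph n H \<and>
        connected_graph H \<and> \<not> trivial_subgraph n H \<and> edges G \<subseteq> edges H"
      "is_spanning_subgraph H' (square_cycle n) \<and> convex_subgraph n H' \<and>
        connected_graph H' \<and> \<not> trivial_subgraph n H' \<and> edges G \<subseteq> edges H'"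
    then show "H = H'" using nontrivial_convex_unique[OF n tree[OF G]] by blast
  qed
next
  note n = assms
  show "spanning_trees (square_cycle n) =
      (\<Union>k\<in>{0..\<lceil>(real n - 2) / 2\<rceil>}. \<Union>j\<in>{0..int n - 1}. spanning_trees (S_graph n k j))"
  proof (intro equalityI subsetI)
    fix G assume "G \<in> spanning_trees (square_cycle n)"
    then have G: "is_spanning_tree G (square_cycle n)" by (simp add: spanning_trees_def)
    obtain H where "is_spanning_subgraph H (square_cycle n)" "convex_subgraph n H"
      "connected_graph H" "\<not> trivial_subgraph n H" and sub: "edges G \<subseteq> edges H"
      using exists_nontrivial_convex[OF n G] .
    then obtain k j where kj: "0 \<le> k" "2 * k + 1 \<le> int n" "0 \<le> j" "j < int n" "H = S_graph n k j"
      using nontrivial_convex_is_S_graph[OF n] by metis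
    then have "G \<in> spanning_trees (S_graph n k j)"
      using G sub by (simp add: spanning_trees_def spanning_tree_S_graph_iff[OF n])
    then show "G \<in> (\<Union>k\<in>{0..\<lceil>(real n - 2) / 2\<rceil>}. \<Union>j\<in>{0..int n - 1}. spanning_trees (S_graph n k j))"
      using kj by (intro UN_I[of k] UN_I[of j]) (auto simp: le_ceiling_half_iff)
  next
    fix G assume "G \<in> (\<Union>k\<in>{0..\<lceil>(real n - 2) / 2\<rceil>}. \<Union>j\<in>{0..int n - 1}. spanning_trees (S_graph n k j))"
    then show "G \<in> spanning_trees (square_cycle n)"
      by (auto simp: spanning_trees_def spanning_tree_S_graph_iff[OF n])
  qed
next
  note n = assms
  show "disjoint_family_on (\<lambda>(k, j). spanning_trees (S_graph n k j))
      ({0..\<lceil>(real n - 2) / 2\<rceil>} \<times> {0..int n - 1})"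
    unfolding disjoint_family_on_def
  proof (intro ballI impI, rule ccontr)
    fix p q
    assume pq: "p \<in> {0..\<lceil>(real n - 2) / 2\<rceil>} \<times> {0..int n - 1}"
      "q \<in> {0..\<lceil>(real n - 2) / 2\<rceil>} \<times> {0..int n - 1}" "p \<noteq> q"
      and meet: "(case p of (k, j) \<Rightarrow> spanning_trees (S_graph n k j)) \<inter>
        (case q of (k, j) \<Rightarrow> spanning_trees (S_graph n k j)) \<noteq> {}"
    obtain k j k' j' where eq: "p = (k, j)" "q = (k', j')" by (cases p, cases q)
    have k: "0 \<le> k" "2 * k + 1 \<le> int n" and k': "0 \<le> k'" "2 * k' + 1 \<le> int n"
      and j: "0 \<le> j" "j < int n" "0 \<le> j'" "j' < int n"
      using pq by (auto simp: eq le_ceiling_half_iff)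
    from meet obtain G where G: "is_spanning_tree G (square_cycle n)"
      "edges G \<subseteq> edges (S_graph n k j)" "edges G \<subseteq> edges (S_graph n k' j')"
      by (auto simp: eq spanning_trees_def spanning_tree_S_graph_iff[OF n])
    have "vertices G = {0..<int n}" "connected_graph G"
      using G(1) by (auto simp: is_spanning_tree_def is_tree_def spanning_subgraph_iff[OF n])
    \<comment> \<open>Both graphs are nontrivial convex graphs containing the same tree, so
      uniqueness applies.\<close>
    then have "S_graph n k j = S_graph n k' j'"
      using nontrivial_convex_unique[OF n] S_graph_spanning[OF n] S_graph_convex[OF n]
        S_graph_nontrivial[OF n] k k' G by metis
    then show False using S_graph_inj[OF n k k' j] pq(3) eq by simp
  qed
qed

end
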